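(* If $T$ is a right lattice triangle whose centroid is a lattice point, then the lattice length of each side of $T$ is a multiple of $3$; in particular the lattice perimeter of $T$ is at least $9$. Moreover, for every multiple $\ell$ of $3$ with $\ell>6$, there exists a right lattice triangle of lattice perimeter $\ell$ whose centroid is a lattice point.
   Context: A lattice point is an element of $\mathbb Z^2\subseteq\mathbb R^2$. A lattice triangle is a (nondegenerate) triangle in $\mathbb R^2$ whose three vertices are lattice points. The lattice length of a segment joining two lattice points is the number of lattice points on the segment (endpoints included) minus one. The lattice perimeter of a lattice triangle is the sum of the lattice lengths of its three sides. A triangle is right if one of its interior angles equals $\pi/2$. *)

theory Defs
  imports "HOL-Analysis.Analysis"
begin

definition lattice_point :: "real ^ 2 \<Rightarrow> bool" where
  "lattice_point p \<longleftrightarrow> (\<forall>i. p $ i \<in> \<int>)"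

(* A triangle is given by its three vertices; its sides are the closed segments
   joining them, and it is nondegenerate iff the vertices are not collinear. *)
definition lattice_triangle :: "real ^ 2 \<Rightarrow> real ^ 2 \<Rightarrow> real ^ 2 \<Rightarrow> bool" where
  "lattice_triangle a b c \<longleftrightarrow>
     lattice_point a \<and> lattice_point b \<and> lattice_point c \<and> \<not> collinear {a, b, c}"

(* The set counted is finite and contains both endpoints when these are lattice points,
   so for such segments neither card nor the truncated subtraction degenerates. *)
definition lattice_length :: "real ^ 2 \<Rightarrow> real ^ 2 \<Rightarrow> nat" where
  "lattice_length a b = card {p \<in> closed_segment a b. lattice_point p} - 1"

definition lattice_perimeter :: "real ^ 2 \<Rightarrow> real ^ 2 \<Rightarrow> real ^ 2 \<Rightarrow> nat" where
  "lattice_perimeter a b c = lattice_length a b + lattice_length b c + lattice_length c a"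

(* interior angle at the vertex q of the triangle p, q, r *)
definition vertex_angle :: "real ^ 2 \<Rightarrow> real ^ 2 \<Rightarrow> real ^ 2 \<Rightarrow> real" where
  "vertex_angle p q r = arccos (((p - q) \<bullet> (r - q)) / (norm (p - q) * norm (r - q)))"

definition right_triangle :: "real ^ 2 \<Rightarrow> real ^ 2 \<Rightarrow> real ^ 2 \<Rightarrow> bool" where
  "right_triangle a b c \<longleftrightarrow>
     vertex_angle b a c = pi / 2 \<or> vertex_angle a b c = pi / 2 \<or> vertex_angle a c b = pi / 2"

definition centroid :: "real ^ 2 \<Rightarrow> real ^ 2 \<Rightarrow> real ^ 2 \<Rightarrow> real ^ 2" where
  "centroid a b c = (1 / 3) *\<^sub>R (a + b + c)"

end

(* If the right angle is at a and u = b - a, v = c - a, then integrality of the centroid says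
   u + v = 0 modulo 3, so 0 = u . v = - |u|^2 modulo 3.  As -1 is not a square modulo 3, this
   forces u = v = 0 modulo 3, and all sides are divisible by 3.  Conversely, the triangle with
   vertices (0,0), (3k,0), (0,3) has sides of lattice length 3k, 3, 3. *)

theory Submission
  imports Defs
begin

lemma lattice_point_iff: "lattice_point p \<longleftrightarrow> p $ 1 \<in> \<int> \<and> p $ 2 \<in> \<int>"
  by (simp add: lattice_point_def forall_2)

lemma lattice_point_diff:
  "lattice_point a \<Longrightarrow> lattice_point b \<Longrightarrow> lattice_point (a - b)"
  by (simp add: lattice_point_def)

text \<open>Degenerate angles fit the equivalence: if \<open>p = q\<close> or \<open>r = q\<close>,
  the quotient is 0/0 = 0, whose \<open>arccos\<close> is pi/2, and the inner product vanishes
  too.\<close>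

lemma vertex_angle_eq_right_iff:
  "vertex_angle p q r = pi / 2 \<longleftrightarrow> (p - q) \<bullet> (r - q) = 0"
proof
  let ?z = "((p - q) \<bullet> (r - q)) / (norm (p - q) * norm (r - q))"
  assume "vertex_angle p q r = pi / 2"
  then have "arccos ?z = pi / 2"
    by (simp add: vertex_angle_def)
  \<comment> \<open>Cauchy-Schwarz places \<open>?z\<close> in [-1, 1], where \<open>cos\<close>
    inverts \<open>arccos\<close>.\<close>
  moreover have "\<bar>?z\<bar> \<le> 1"
    using Cauchy_Schwarz_ineq2[of "p - q" "r - q"]
    by (cases "p = q \<or> r = q") (auto simp: abs_mult divide_le_eq_1)
  ultimately have "?z = 0"
    by (metis abs_le_iff cos_arccos cos_pi_half minus_le_iff)
  then show "(p - q) \<bullet> (r - q) = 0"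
    by auto
qed (simp add: vertex_angle_def)

lemma right_triangle_iff:
  "right_triangle a b c \<longleftrightarrow>
     (b - a) \<bullet> (c - a) = 0 \<or> (a - b) \<bullet> (c - b) = 0 \<or> (a - c) \<bullet> (b - c) = 0"
  unfolding right_triangle_def vertex_angle_eq_right_iff ..

text \<open>Since (x, y) is primitive, the lattice points on the segment are exactly a + k (x, y)
  for k = 0, ..., n. These are n + 1 points, and the \<open>- 1\<close> in
  \<open>lattice_length\<close> leaves n.\<close>

lemma lattice_length_primitive:
  fixes x y :: int
  assumes a: "lattice_point a" and cop: "coprime x y"
    and b: "b $ 1 = a $ 1 + real n * of_int x" "b $ 2 = a $ 2 + real n * of_int y"
  shows "lattice_length a b = n"
proof -
  define f where "f k = (\<chi> i. a $ i + real k * (if i = 1 then of_int x else of_int y))" for k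
  have f: "f k $ 1 = a $ 1 + real k * of_int x" "f k $ 2 = a $ 2 + real k * of_int y" for k
    by (simp_all add: f_def)
  obtain r s where rs: "r * x + s * y = 1"
    using cop bezout_int[of x y] by auto
  have rs': "of_int r * of_int x + of_int s * of_int y = (1::real)"
    using rs by (metis of_int_1 of_int_add of_int_mult)
  have "{p \<in> closed_segment a b. lattice_point p} = f ` {..n}"
  proof (intro set_eqI iffI)
    fix p assume "p \<in> {p \<in> closed_segment a b. lattice_point p}"
    then obtain u where u: "0 \<le> u" "u \<le> 1" "p = (1 - u) *\<^sub>R a + u *\<^sub>R b" and p: "lattice_point p"
      by (auto simp: in_segment)
    have p12: "p $ 1 = a $ 1 + u * real n * of_int x" "p $ 2 = a $ 2 + u * real n * of_int y"
      unfolding u(3) vector_add_component vector_scaleR_component b by (simp_all add: algebra_simps)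
    \<comment> \<open>The Bezout functional (r, s) takes the value 1 on (x, y), so on the integer
      vector p - a = u n (x, y) it takes the value u n, which is therefore an integer.\<close>
    have "of_int r * (p $ 1 - a $ 1) + of_int s * (p $ 2 - a $ 2) \<in> \<int>"
      using a p by (simp add: lattice_point_iff)
    also have "of_int r * (p $ 1 - a $ 1) + of_int s * (p $ 2 - a $ 2)
        = u * real n * (of_int r * of_int x + of_int s * of_int y)"
      unfolding p12 by (simp add: algebra_simps)
    finally have "u * real n \<in> \<int>"
      by (simp add: rs')
    then have "u * real n \<in> \<nat>"
      using u by (simp add: Nats_altdef2)
    then obtain k where k: "u * real n = real k"
      by (elim Nats_cases) auto
    have "real k \<le> real n"
      using u mult_left_le_one_le[of "real n" u] by (simp flip: k)
    moreover have "p = f k"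
      using p12 k by (simp add: vec_eq_iff forall_2 f)
    ultimately show "p \<in> f ` {..n}"
      by simp
  next
    fix p assume "p \<in> f ` {..n}"
    then obtain k where k: "k \<le> n" "p = f k"
      by auto
    \<comment> \<open>For n = 0 the parameter k/n is 0/0 = 0, which is correct because then a = b =
      p.\<close>
    have "p = (1 - real k / real n) *\<^sub>R a + (real k / real n) *\<^sub>R b"
      using k b by (cases "n = 0") (simp_all add: vec_eq_iff forall_2 f field_simps)
    then have "p \<in> closed_segment a b"
      using k unfolding in_segment
      by (intro exI[of _ "real k / real n"]) (auto simp: divide_le_eq_1)
    moreover have "lattice_point p"
      using a k by (simp add: lattice_point_iff f)
    ultimately show "p \<in> {p \<in> closed_segment a b. lattice_point p}"
      by simp
  qed
  moreover have "inj f"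
  proof
    fix k l assume "f k = f l"
    then have "real k * of_int x = real l * of_int x" "real k * of_int y = real l * of_int y"
      by (metis f(1) add_left_cancel, metis f(2) \<open>f k = f l\<close> add_left_cancel)
    moreover have "x \<noteq> 0 \<or> y \<noteq> 0"
      using cop by auto
    ultimately show "k = l"
      by auto
  qed
  ultimately show ?thesis
    by (simp add: lattice_length_def card_image inj_on_subset)
qed

text \<open>A nonzero integer vector is its gcd times a primitive vector, which reduces the claim to
  the primitive case.\<close>

lemma lattice_length_gcd:
  fixes x y :: int
  assumes a: "lattice_point a" and "b $ 1 = a $ 1 + of_int x" "b $ 2 = a $ 2 + of_int y"
  shows "lattice_length a b = nat (gcd x y)"
proof (cases "x = 0 \<and> y = 0")
  case True
  \<comment> \<open>The zero vector determines no primitive direction; (1, 0) with multiplier 0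
    serves.\<close>
  then show ?thesis
    using assms lattice_length_primitive[of a 1 0 b 0] by simp
next
  case False
  then obtain x' y' where xy: "x = x' * gcd x y" "y = y' * gcd x y" "coprime x' y'"
    using gcd_coprime_exists[of x y] by auto
  have "real_of_int x = real (nat (gcd x y)) * of_int x'"
    by (subst xy(1)) simp
  moreover have "real_of_int y = real (nat (gcd x y)) * of_int y'"
    by (subst xy(2)) simp
  ultimately show ?thesis
    using assms xy(3) by (intro lattice_length_primitive[of a x' y']) simp_all
qed

lemma lattice_length_pos:
  assumes "lattice_point a" "lattice_point b" "a \<noteq> b"
  shows "lattice_length a b > 0"
proof -
  obtain x y :: int where xy: "(b - a) $ 1 = of_int x" "(b - a) $ 2 = of_int y"
    using assms lattice_point_diff[of b a] unfolding lattice_point_iff by (metis Ints_cases)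
  then have "lattice_length a b = nat (gcd x y)"
    using assms by (intro lattice_length_gcd) (simp_all add: algebra_simps)
  moreover have "x \<noteq> 0 \<or> y \<noteq> 0"
    using xy assms(3) by (auto simp: vec_eq_iff forall_2)
  ultimately show ?thesis
    by simp
qed

text \<open>This transfers divisibility from side vectors to lattice lengths: a common factor of
  both coordinates divides their gcd.\<close>

lemma dvd_lattice_length:
  assumes "lattice_point a" "lattice_point w" "b - a = real n *\<^sub>R w"
  shows "n dvd lattice_length a b"
proof -
  obtain x y :: int where xy: "w $ 1 = of_int x" "w $ 2 = of_int y"
    using assms(2) by (auto simp: lattice_point_iff elim!: Ints_cases)
  have "b = a + real n *\<^sub>R w"
    using assms(3) by (simp add: algebra_simps)
  then have "lattice_length a b = nat (gcd (int n * x) (int n * y))"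
    using assms(1) xy by (intro lattice_length_gcd) simp_all
  moreover have "int n dvd gcd (int n * x) (int n * y)"
    by simp
  ultimately show ?thesis
    by (metis gcd_ge_0_int int_dvd_int_iff int_nat_eq)
qed

text \<open>Squares are 0 or 1 modulo 3, so two of them sum to 0 modulo 3 only if both are
  0.\<close>

lemma three_dvd_sum_squares:
  fixes x y :: int
  assumes "3 dvd x\<^sup>2 + y\<^sup>2"
  shows "3 dvd x \<and> 3 dvd y"
proof -
  have sq: "z\<^sup>2 mod 3 = (if 3 dvd z then 0 else 1)" for z :: int
  proof -
    have sq_mod: "z\<^sup>2 mod 3 = (z mod 3)\<^sup>2 mod 3"
      by (simp add: power_mod)
    consider "z mod 3 = 0" | "z mod 3 = 1" | "z mod 3 = 2"
      by linarith
    then show ?thesis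
      by cases (simp_all add: sq_mod dvd_eq_mod_eq_0)
  qed
  have "(x\<^sup>2 mod 3 + y\<^sup>2 mod 3) mod 3 = 0"
    unfolding mod_add_eq using assms by (rule dvd_imp_mod_0)
  then show ?thesis
    unfolding sq by (simp split: if_splits)
qed

lemma orthogonal_legs_dvd_three:
  assumes "lattice_point a" "lattice_point b" "lattice_point c"
    and orth: "(b - a) \<bullet> (c - a) = 0"
    and cent: "lattice_point (centroid a b c)"
  shows "\<exists>u v. lattice_point u \<and> lattice_point v \<and> b - a = 3 *\<^sub>R u \<and> c - a = 3 *\<^sub>R v"
proof -
  \<comment> \<open>Here 3 g = (b - a) + (c - a), so integrality of g is the congruence between the
    two legs modulo 3.\<close>
  define g where "g = centroid a b c - a"
  have "lattice_point g"
    using assms by (simp add: g_def lattice_point_diff)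
  then obtain k l :: int where g: "g $ 1 = of_int k" "g $ 2 = of_int l"
    by (auto simp: lattice_point_iff elim!: Ints_cases)
  obtain x y :: int where xy: "(b - a) $ 1 = of_int x" "(b - a) $ 2 = of_int y"
    using assms lattice_point_diff[of b a] unfolding lattice_point_iff by (metis Ints_cases)
  \<comment> \<open>Eliminating the second leg turns orthogonality into |b - a|^2 = 3 (b - a) . g,
    so 3 divides a sum of two integer squares.\<close>
  have cg: "c - a = 3 *\<^sub>R g - (b - a)"
    by (simp add: g_def centroid_def vec_eq_iff field_simps)
  have "real_of_int (x * (3 * k - x) + y * (3 * l - y)) = (b - a) \<bullet> (c - a)"
    unfolding cg inner_vec_def sum_2 using g xy by simp
  then have "x * (3 * k - x) + y * (3 * l - y) = 0"
    using orth by (metis of_int_eq_0_iff)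
  then have "x\<^sup>2 + y\<^sup>2 = 3 * (x * k + y * l)"
    by (simp add: algebra_simps power2_eq_square)
  then have "3 dvd x" "3 dvd y"
    using three_dvd_sum_squares[of x y] by auto
  then obtain x' y' where "x = 3 * x'" "y = 3 * y'"
    by (meson dvdE)
  then have u: "lattice_point ((1/3) *\<^sub>R (b - a))"
    using xy by (simp add: lattice_point_iff)
  show ?thesis
    using u lattice_point_diff[OF \<open>lattice_point g\<close> u]
    by (intro exI[of _ "(1/3) *\<^sub>R (b - a)"] exI[of _ "g - (1/3) *\<^sub>R (b - a)"])
       (simp add: cg algebra_simps)
qed

text \<open>Both legs vanish modulo 3, so all vertices are congruent to \<open>a\<close>, and hence
  to each other, modulo 3. Allowing any ordered pair of vertices covers the hypotenuse and both
  orientations of each side, so the result survives relabelling the triangle.\<close>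

lemma right_triangle_lattice_length_dvd_three:
  assumes "lattice_point a" "lattice_point b" "lattice_point c"
    and "(b - a) \<bullet> (c - a) = 0" "lattice_point (centroid a b c)"
    and pq: "p \<in> {a, b, c}" "q \<in> {a, b, c}"
  shows "3 dvd lattice_length p q"
proof -
  obtain u v where uv: "lattice_point u" "lattice_point v" "b - a = 3 *\<^sub>R u" "c - a = 3 *\<^sub>R v"
    using orthogonal_legs_dvd_three assms by blast
  have *: "\<exists>w. lattice_point w \<and> r - a = 3 *\<^sub>R w" if "r \<in> {a, b, c}" for r
    using that uv by (auto intro: exI[of _ 0] simp: lattice_point_iff)
  obtain w w' where w: "lattice_point w" "p - a = 3 *\<^sub>R w" "lattice_point w'" "q - a = 3 *\<^sub>R w'"
    using *[OF pq(1)] *[OF pq(2)] by blast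
  have "q - p = (q - a) - (p - a)"
    by simp
  also have "\<dots> = real 3 *\<^sub>R (w' - w)"
    unfolding w by (simp add: algebra_simps)
  finally show ?thesis
    using assms w by (intro dvd_lattice_length[of _ "w' - w"]) (auto intro: lattice_point_diff)
qed

lemma right_lattice_triangle_sides:
  assumes "lattice_triangle a b c" "right_triangle a b c" "lattice_point (centroid a b c)"
  shows "3 dvd lattice_length a b \<and> 3 dvd lattice_length b c \<and> 3 dvd lattice_length c a"
proof -
  have lat: "lattice_point a" "lattice_point b" "lattice_point c"
    using assms(1) by (auto simp: lattice_triangle_def)
  \<comment> \<open>The centroid is symmetric in the vertices, so the vertex with the right angle
    may be listed first.\<close>
  have perm: "centroid b a c = centroid a b c" "centroid c a b = centroid a b c"
    by (simp_all add: centroid_def add_ac)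
  consider "(b - a) \<bullet> (c - a) = 0" | "(a - b) \<bullet> (c - b) = 0" | "(a - c) \<bullet> (b - c) = 0"
    using assms(2) by (auto simp: right_triangle_iff)
  then show ?thesis
  proof cases
    case 1
    show ?thesis
      using right_triangle_lattice_length_dvd_three[OF lat 1 assms(3)] by simp
  next
    case 2
    show ?thesis
      using right_triangle_lattice_length_dvd_three[OF lat(2,1,3) 2] assms(3) perm by simp
  next
    case 3
    show ?thesis
      using right_triangle_lattice_length_dvd_three[OF lat(3,1,2) 3] assms(3) perm by simp
  qed
qed

lemma right_lattice_triangle_perimeter:
  assumes "lattice_triangle a b c" "right_triangle a b c" "lattice_point (centroid a b c)"
  shows "lattice_perimeter a b c \<ge> 9"
proof -
  have "a \<noteq> b" "b \<noteq> c" "c \<noteq> a"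
    using assms(1) by (auto simp: lattice_triangle_def insert_commute)
  then have "lattice_length a b > 0" "lattice_length b c > 0" "lattice_length c a > 0"
    using assms(1) by (auto simp: lattice_triangle_def intro: lattice_length_pos)
  \<comment> \<open>A positive multiple of 3 is at least 3.\<close>
  then have "lattice_length a b \<ge> 3" "lattice_length b c \<ge> 3" "lattice_length c a \<ge> 3"
    using right_lattice_triangle_sides[OF assms] by (auto dest: dvd_imp_le)
  then show ?thesis
    by (simp add: lattice_perimeter_def)
qed

lemma right_lattice_triangle_exists:
  assumes "3 dvd l" "l > 6"
  shows "\<exists>a b c. lattice_triangle a b c \<and> right_triangle a b c \<and>
           lattice_point (centroid a b c) \<and> lattice_perimeter a b c = l"
proof -
  obtain m where "l = 3 * m"
    using assms by (meson dvdE)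
  \<comment> \<open>The legs will have lattice lengths 3k and 3 and the hypotenuse 3, for a total of
    3k + 6; l > 6 makes k positive and the triangle nondegenerate.\<close>
  then obtain k where k: "l = 3 * k + 6" "k > 0"
    using assms(2) that[of "m - 2"] by auto
  define b c :: "real ^ 2" where "b = vector [3 * real k, 0]" and "c = vector [0, 3]"
  have b: "b $ 1 = 3 * real k" "b $ 2 = 0" and c: "c $ 1 = 0" "c $ 2 = 3"
    by (simp_all add: b_def c_def)
  have lat: "lattice_point 0" "lattice_point b" "lattice_point c"
    by (simp_all add: lattice_point_iff b c)
  have "\<not> collinear {0, b, c}"
  proof
    assume "collinear {0, b, c}"
    then consider "b = 0" | "c = 0" | t where "c = t *\<^sub>R b"
      by (auto simp: collinear_lemma)
    then show False
      using b c k by cases (auto simp: vec_eq_iff forall_2)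
  qed
  then have "lattice_triangle 0 b c"
    using lat by (simp add: lattice_triangle_def)
  moreover have "right_triangle 0 b c"
    by (simp add: right_triangle_iff inner_vec_def sum_2 b c)
  moreover have "lattice_point (centroid 0 b c)"
    by (simp add: lattice_point_iff centroid_def b c)
  moreover have "lattice_length 0 b = 3 * k"
    using lat b by (intro lattice_length_primitive[of _ 1 0]) simp_all
  \<comment> \<open>The hypotenuse vector is 3 (-k, 1), and (-k, 1) is primitive for every k, so
    this length does not grow with k.\<close>
  moreover have "lattice_length b c = 3"
    using lat b c by (intro lattice_length_primitive[of _ "- int k" 1]) simp_all
  moreover have "lattice_length c 0 = 3"
    using lat c by (intro lattice_length_primitive[of _ 0 "-1"]) simp_all
  ultimately show ?thesis
    using k by (intro exI[of _ 0] exI[of _ b] exI[of _ c]) (simp add: lattice_perimeter_def)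
qed

theorem mainTheorem7:
  shows "(\<forall>a b c. lattice_triangle a b c \<and> right_triangle a b c \<and> lattice_point (centroid a b c) \<longrightarrow>
            3 dvd lattice_length a b \<and> 3 dvd lattice_length b c \<and> 3 dvd lattice_length c a \<and>
            lattice_perimeter a b c \<ge> 9) \<and>
         (\<forall>l::nat. 3 dvd l \<and> l > 6 \<longrightarrow>
            (\<exists>a b c. lattice_triangle a b c \<and> right_triangle a b c \<and>
               lattice_point (centroid a b c) \<and> lattice_perimeter a b c = l))"
  using right_lattice_triangle_sides right_lattice_triangle_perimeter right_lattice_triangle_exists
  by blast

end
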